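(* Let $m \geq 44$ be an integer, let $G$ be a $2n$-vertex graph of maximum degree $m$, and let $\mathcal{G} = \{G_1, \dots, G_n\}$ be a family of spanning subgraphs of $G$, each of minimum degree at least $10\log(m)+6$. If $\mathcal{G}$ contains a perfect matching transversal, then $\mathcal G$ contains at least $\left\lceil \frac{1}{2}\log m\right\rceil !$ distinct perfect matching transversals.
   Context: All graphs are finite and simple; $\log$ is the natural logarithm; $[n]=\{1,\dots,n\}$. The members of a family $\mathcal G=\{G_1,\dots,G_n\}$ of subgraphs of $G$ are indexed and not necessarily distinct. A $\mathcal G$-transversal is a pair $(T,\phi)$ where $T\subseteq E(G)$ and $\phi:T\to[n]$ is a bijection with $e\in E(G_{\phi(e)})$ for every $e\in T$. It is a perfect matching transversal if $T$ is a perfect matching on $V(G)$. Transversals are distinct if they are distinct as pairs. "$\mathcal G$ contains a transversal" means that a $\mathcal G$-transversal exists. *)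

theory Defs
  imports Complex_Main "HOL-Library.FuncSet" "HOL-Library.Disjoint_Sets"
begin

record 'a ugraph =
  vertices :: "'a set"
  edges :: "'a set set"

definition simple_graph :: "'a ugraph \<Rightarrow> bool" where
  "simple_graph G \<longleftrightarrow>
     finite (vertices G) \<and> (\<forall>e\<in>edges G. e \<subseteq> vertices G \<and> card e = 2)"

definition spanning_subgraph :: "'a ugraph \<Rightarrow> 'a ugraph \<Rightarrow> bool" where
  "spanning_subgraph H G \<longleftrightarrow>
     simple_graph H \<and> vertices H = vertices G \<and> edges H \<subseteq> edges G"

definition vertex_degree :: "'a ugraph \<Rightarrow> 'a \<Rightarrow> nat" where
  "vertex_degree G v = card {e \<in> edges G. v \<in> e}"

text \<open>Inserting 0 only matters for the graph without vertices, whose maximum degree is thereby 0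
  instead of unspecified. The minimum degree is meaningful for nonempty graphs only.\<close>

definition max_degree :: "'a ugraph \<Rightarrow> nat" where
  "max_degree G = Max (insert 0 (vertex_degree G ` vertices G))"

definition min_degree :: "'a ugraph \<Rightarrow> nat" where
  "min_degree G = Min (vertex_degree G ` vertices G)"

definition perfect_matching :: "'a ugraph \<Rightarrow> 'a set set \<Rightarrow> bool" where
  "perfect_matching G M \<longleftrightarrow> M \<subseteq> edges G \<and> disjoint M \<and> \<Union>M = vertices G"

text \<open>A function with domain \<open>T\<close> is represented by a total function that is \<open>undefined\<close> outside
  \<open>T\<close>; without \<open>extensional T\<close> one transversal would correspond to many pairs.\<close>

definition is_transversal ::
  "'a ugraph \<Rightarrow> nat \<Rightarrow> (nat \<Rightarrow> 'a ugraph) \<Rightarrow> 'a set set \<times> ('a set \<Rightarrow> nat) \<Rightarrow> bool" where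
  "is_transversal G n \<G> = (\<lambda>(T, \<phi>).
     T \<subseteq> edges G \<and> \<phi> \<in> extensional T \<and> bij_betw \<phi> T {1..n} \<and>
     (\<forall>e\<in>T. e \<in> edges (\<G> (\<phi> e))))"

definition pm_transversals ::
  "'a ugraph \<Rightarrow> nat \<Rightarrow> (nat \<Rightarrow> 'a ugraph) \<Rightarrow> ('a set set \<times> ('a set \<Rightarrow> nat)) set" where
  "pm_transversals G n \<G> = {(T, \<phi>). is_transversal G n \<G> (T, \<phi>) \<and> perfect_matching G T}"

end

theory Submission
  imports Defs
begin

text \<open>
  Let \<open>e\<^sub>1, \<dots>, e\<^sub>n\<close> be the edges of the given transversal, \<open>e\<^sub>i\<close> having colour \<open>i\<close>. Split every \<open>e\<^sub>i\<close> into
  a left end \<open>a\<^sub>i\<close> and a right end \<open>b\<^sub>i\<close>, and form the auxiliary bipartite graph in which \<open>a\<^sub>i\<close> is adjacent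
  to \<open>b\<^sub>j\<close> if \<open>{a\<^sub>i, b\<^sub>j}\<close> is an edge of the \<open>i\<close>th graph of the family. A perfect matching of this graph
  sends each \<open>a\<^sub>i\<close> to some \<open>b\<^bsub>\<sigma> i\<^esub>\<close>, and giving this edge colour \<open>i\<close> yields a perfect matching transversal;
  distinct matchings give distinct transversals
  (\<open>card_representatives_le_card_pm_transversals\<close>). The identity is a perfect matching of the
  auxiliary graph. So by Marshall Hall's theorem (\<open>card_representatives_ge_fact\<close>) there are at least
  \<open>k!\<close> transversals as soon as every \<open>a\<^sub>i\<close> has degree at least \<open>k\<close>, where \<open>k = \<lceil>ln m / 2\<rceil>\<close>.

  It remains to choose the sides of the ends well (\<open>ex_endpoint_choice\<close>). If they are chosen at
  random, an end that is put on the left is expected to see at least half as many right ends as it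
  sees edges \<open>e\<^sub>j\<close> with \<open>j \<noteq> i\<close>, of which there are at least \<open>10 * k - 7\<close> by the minimum degree. It sees
  fewer than \<open>k - 1\<close> of them with a probability that is small compared with the reciprocal of the
  number of other ends whose success depends on a common choice, a number bounded through the maximum
  degree \<open>m \<le> 9 ^ k\<close>. This is the situation of the local lemma, used here in the elementary counting
  form of Rosenfeld (\<open>card_avoiding_insert_ge\<close>): deciding the edges one at a time, each new edge
  multiplies the number of good partial choices by at least a factor \<open>\<beta> > 0\<close>, so a good choice of all sides
  exists.
\<close>

section \<open>Perfect matchings of bipartite graphs\<close>

text \<open>These are the perfect matchings of the bipartite graph in which \<open>i\<close> is adjacent to the elements
  of \<open>N i\<close>. Making them extensional leaves exactly one function per matching, so that they can be
  counted.\<close>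

definition representatives :: "('i \<Rightarrow> 'j set) \<Rightarrow> 'i set \<Rightarrow> 'j set \<Rightarrow> ('i \<Rightarrow> 'j) set" where
  "representatives N I J = {f \<in> PiE I N. bij_betw f I J}"

lemma finite_representatives:
  assumes "finite I" "finite J"
  shows "finite (representatives N I J)"
proof (rule finite_subset)
  show "representatives N I J \<subseteq> PiE I (\<lambda>_. J)"
    by (auto simp: representatives_def PiE_def bij_betw_def)
  show "finite (PiE I (\<lambda>_. J))"
    using assms by (simp add: finite_PiE)
qed

text \<open>Give every vertex of a directed path the partner of its successor. This frees the partner of the
  first vertex and leaves the last vertex without a partner; joining these two completes a new
  perfect matching whenever they are adjacent. By induction from the far end of the path, each step
  changes \<open>g\<close> in one point only, because outside the shorter path \<open>g\<close> still agrees with \<open>f\<close>.\<close>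

lemma shift_along_path:
  assumes "bij_betw f I J" "\<And>i. i \<in> I \<Longrightarrow> f i \<in> N i"
    and "distinct xs" "xs \<noteq> []" "set xs \<subseteq> I" "successively (\<lambda>i j. f j \<in> N i) xs"
  shows "\<exists>g. bij_betw g (I - {last xs}) (J - {f (hd xs)}) \<and>
             (\<forall>i \<in> I - {last xs}. g i \<in> N i) \<and> (\<forall>i \<in> I - set xs. g i = f i)"
  using assms(3-6)
proof (induction xs rule: induct_list012)
  case (2 x)
  then show ?case
    using assms(1,2) by (intro exI[of _ f]) (auto simp: bij_betw_def inj_on_def)
next
  case (3 x y ys)
  let ?l = "last (y # ys)"
  from 3 obtain g where g: "bij_betw g (I - {?l}) (J - {f y})"
    "\<forall>i \<in> I - {?l}. g i \<in> N i" "\<forall>i \<in> I - set (y # ys). g i = f i"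
    by auto
  have x: "x \<in> I" "x \<noteq> ?l" "x \<noteq> y" "y \<in> I" "f y \<in> N x" "g x = f x"
    using 3 g(3) last_in_set[of "y # ys"] by auto
  have fxy: "f x \<noteq> f y" "f y \<in> J"
    using x assms(1) by (auto simp: bij_betw_def inj_on_def)
  have "bij_betw (g(x := f y)) (I - {?l}) (J - {f x})"
    unfolding bij_betw_def
  proof
    have inj: "inj_on g (I - {?l})" and img: "g ` (I - {?l}) = J - {f y}"
      using g(1) by (auto simp: bij_betw_def)
    have img': "g ` (I - {?l} - {x}) = J - {f y} - {f x}"
      using inj_on_image_set_diff[OF inj, of "I - {?l}" "{x}"] x img by auto
    show "inj_on (g(x := f y)) (I - {?l})"
      using inj img by (intro inj_on_fun_updI) auto
    have "(g(x := f y)) ` (I - {?l}) = insert (f y) (g ` (I - {?l} - {x}))"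
      using x by (subst fun_upd_image) simp
    then show "(g(x := f y)) ` (I - {?l}) = J - {f x}"
      using img' fxy by auto
  qed
  moreover have "\<forall>i \<in> I - {?l}. (g(x := f y)) i \<in> N i" "\<forall>i \<in> I - set (x # y # ys). (g(x := f y)) i = f i"
    using g x by auto
  ultimately show ?case
    by (metis last_ConsR list.distinct(1) list.sel(1))
qed auto

lemma rtranclp_distinct_path:
  assumes "R\<^sup>*\<^sup>* x y"
  shows "\<exists>xs. xs \<noteq> [] \<and> hd xs = x \<and> last xs = y \<and> distinct xs \<and> successively R xs"
  using assms
proof (induction rule: converse_rtranclp_induct)
  case base
  show ?case by (intro exI[of _ "[y]"]) auto
next
  case (step x z)
  then obtain xs where xs: "xs \<noteq> []" "hd xs = z" "last xs = y" "distinct xs" "successively R xs"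
    by auto
  show ?case
  proof (cases "x \<in> set xs")
    case True
    then obtain us vs where "xs = us @ x # vs"
      by (meson split_list)
    with xs show ?thesis
      by (intro exI[of _ "x # vs"]) (auto simp: successively_append_iff)
  next
    case False
    with xs step(1) show ?thesis
      by (intro exI[of _ "x # xs"]) (auto simp: successively_Cons)
  qed
qed

text \<open>A vertex that reaches as few vertices as possible lies in a terminal strong component: each of its
  successors reaches at most as much, hence exactly as much, and so in particular reaches it.\<close>

lemma ex_vertex_with_returning_edges:
  fixes R :: "'i \<Rightarrow> 'i \<Rightarrow> bool"
  assumes "finite I" "I \<noteq> {}" "\<And>i j. R i j \<Longrightarrow> j \<in> I"
  obtains v where "v \<in> I" "\<And>w. R v w \<Longrightarrow> R\<^sup>*\<^sup>* w v"
proof -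
  let ?reach = "\<lambda>i. {j. R\<^sup>*\<^sup>* i j}"
  obtain v where v: "v \<in> I" "\<And>i. i \<in> I \<Longrightarrow> card (?reach v) \<le> card (?reach i)"
    using ex_has_least_nat[of "\<lambda>i. i \<in> I" _ "\<lambda>i. card (?reach i)"] assms(2) by blast
  have "R\<^sup>*\<^sup>* w v" if w: "R v w" for w
  proof -
    have "?reach v \<subseteq> insert v I"
      using assms(3) by (auto elim: rtranclp.cases)
    then have "finite (?reach v)"
      using assms(1) by (simp add: finite_subset)
    moreover have "?reach w \<subseteq> ?reach v"
      using w by (auto intro: converse_rtranclp_into_rtranclp)
    ultimately have "?reach w = ?reach v"
      using v(2)[OF assms(3)[OF w]] by (simp add: card_seteq)
    then show ?thesis by auto
  qed
  with v(1) show ?thesis using that by blast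
qed

text \<open>Marshall Hall's lower bound on the number of perfect matchings of a bipartite graph, for classes
  of equal size. Fix a perfect matching \<open>f\<close> and let \<open>i\<close> point to \<open>j\<close> when \<open>i\<close> is adjacent to the partner
  of \<open>j\<close>. For a vertex \<open>v\<close> of a terminal strong component every edge leaving \<open>v\<close> lies on a directed
  cycle, so rotating \<open>f\<close> along the cycle shows that every edge of the bipartite graph at \<open>v\<close> lies in a
  perfect matching. Once such an edge is chosen, deleting both its ends lowers the remaining degrees
  by at most one, and induction gives a factor \<open>k + 1\<close> for the choices at \<open>v\<close>.\<close>

theorem card_representatives_ge_fact:
  assumes "finite I" "finite J" "\<And>i. i \<in> I \<Longrightarrow> N i \<subseteq> J" "k \<le> card I"
    and "\<And>i. i \<in> I \<Longrightarrow> k \<le> card (N i)"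
    and "representatives N I J \<noteq> {}"
  shows "fact k \<le> card (representatives N I J)"
  using assms
proof (induction k arbitrary: I J N)
  case 0
  then show ?case
    using finite_representatives[of I J N] by (simp add: Suc_le_eq card_gt_0_iff)
next
  case (Suc k)
  obtain f where f: "f \<in> PiE I N" "bij_betw f I J"
    using Suc.prems(6) by (auto simp: representatives_def)
  define R where "R i j \<longleftrightarrow> i \<in> I \<and> j \<in> I \<and> f j \<in> N i" for i j
  have "I \<noteq> {}"
    using Suc.prems(4) by auto
  then obtain v where v: "v \<in> I" "\<And>w. R v w \<Longrightarrow> R\<^sup>*\<^sup>* w v"
    using ex_vertex_with_returning_edges[of I R] Suc.prems(1) by (auto simp: R_def)
  have Nv: "finite (N v)"
    using Suc.prems(2,3) v(1) finite_subset by blast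
  have fibre: "fact k \<le> card {h \<in> representatives N I J. h v = w}" if w: "w \<in> N v" for w
  proof -
    let ?N = "\<lambda>i. N i - {w}" and ?I = "I - {v}" and ?J = "J - {w}"
    have "w \<in> J"
      using w v(1) Suc.prems(3) by auto
    then obtain u where u: "u \<in> I" "f u = w"
      using f(2) by (auto simp: bij_betw_def)
    then have "R\<^sup>*\<^sup>* u v"
      using v w by (auto simp: R_def)
    then obtain xs where xs: "xs \<noteq> []" "hd xs = u" "last xs = v" "distinct xs" "successively R xs"
      using rtranclp_distinct_path[of R u v] by blast
    have "set xs \<subseteq> I"
      using xs(5,1,2) u(1)
    proof (induction xs arbitrary: u)
      case (Cons a as)
      then show ?case by (cases as) (auto simp: R_def)
    qed auto
    moreover have "successively (\<lambda>i j. f j \<in> N i) xs"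
      using xs(5) by (rule successively_mono) (auto simp: R_def)
    ultimately obtain g where g: "bij_betw g ?I ?J" "\<forall>i \<in> ?I. g i \<in> N i"
      using shift_along_path[OF f(2), of N xs] f(1) xs u by (auto simp: PiE_iff)
    have "restrict g ?I \<in> representatives ?N ?I ?J"
      using g by (auto simp: representatives_def bij_betw_def PiE_iff)
    then have "fact k \<le> card (representatives ?N ?I ?J)"
    proof (intro Suc.IH)
      show "k \<le> card (N i - {w})" if "i \<in> ?I" for i
        using Suc.prems(5)[of i] that by (auto simp: card_Diff_singleton_if)
    qed (use Suc.prems(1-4) v(1) in auto)
    also have "\<dots> \<le> card {h \<in> representatives N I J. h v = w}"
    proof (rule card_inj_on_le[where f = "\<lambda>h. h(v := w)"])
      show "inj_on (\<lambda>h. h(v := w)) (representatives ?N ?I ?J)"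
      proof (rule inj_onI)
        fix h h' assume h: "h \<in> representatives ?N ?I ?J" "h' \<in> representatives ?N ?I ?J"
          and eq: "h(v := w) = h'(v := w)"
        have "h v = undefined" "h' v = undefined"
          using h by (auto simp: representatives_def PiE_iff extensional_def)
        with eq show "h = h'"
          by (metis fun_upd_triv fun_upd_upd)
      qed
      show "(\<lambda>h. h(v := w)) ` representatives ?N ?I ?J \<subseteq> {h \<in> representatives N I J. h v = w}"
      proof clarify
        fix h assume h: "h \<in> representatives ?N ?I ?J"
        have "bij_betw (h(v := w)) ?I ?J"
          using h by (subst bij_betw_cong[of _ _ h]) (auto simp: representatives_def)
        then have "bij_betw (h(v := w)) (insert v ?I) (insert w ?J)"
          using notIn_Un_bij_betw3[of v ?I "h(v := w)" ?J] by auto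
        then have "bij_betw (h(v := w)) I J"
          using v(1) \<open>w \<in> J\<close> by (simp add: insert_absorb)
        moreover have "h(v := w) \<in> PiE I N"
          using h v(1) w by (auto simp: representatives_def PiE_iff extensional_def)
        ultimately show "h(v := w) \<in> representatives N I J \<and> (h(v := w)) v = w"
          by (simp add: representatives_def)
      qed
      show "finite {h \<in> representatives N I J. h v = w}"
        using finite_representatives[of I J N] Suc.prems(1,2) by simp
    qed
    finally show ?thesis .
  qed
  have "fact (Suc k) \<le> card (N v) * (fact k :: nat)"
    using Suc.prems(5)[OF v(1)] by (simp only: fact_Suc of_nat_id mult_le_mono1)
  also have "\<dots> \<le> (\<Sum>w\<in>N v. card {h \<in> representatives N I J. h v = w})"
    using sum_mono[OF fibre] by simp
  also have "\<dots> = card (\<Union>w\<in>N v. {h \<in> representatives N I J. h v = w})"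
    using Nv finite_representatives[of I J N] Suc.prems(1,2)
    by (intro card_UN_disjoint[symmetric]) auto
  also have "\<dots> \<le> card (representatives N I J)"
    using finite_representatives[of I J N] Suc.prems(1,2) by (intro card_mono) auto
  finally show ?case .
qed

section \<open>A counting form of the local lemma\<close>

text \<open>An event \<open>x\<close> depends only on the coordinates in \<open>D x\<close> and occurs at \<open>A\<close> if \<open>A \<inter> D x \<in> bad x\<close>. Counting
  the subsets of \<open>S\<close> that avoid the events already decided inside \<open>S\<close> makes an induction on \<open>S\<close>
  possible.\<close>

definition avoiding :: "'x set \<Rightarrow> ('x \<Rightarrow> 'i set) \<Rightarrow> ('x \<Rightarrow> 'i set set) \<Rightarrow> 'i set \<Rightarrow> 'i set set" where
  "avoiding X D bad S = {A \<in> Pow S. \<forall>x\<in>X. D x \<subseteq> S \<longrightarrow> A \<inter> D x \<notin> bad x}"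

text \<open>Rosenfeld's counting form of the local lemma. A new coordinate \<open>v\<close> doubles the number of
  candidates. Those destroyed by an event \<open>x\<close> at \<open>v\<close> are determined by a pattern in \<open>bad x\<close> and by their
  trace outside \<open>D x\<close>, which is an avoiding subset of \<open>S - D x\<close>. Restoring the other \<open>card (D x) - 1\<close>
  coordinates of \<open>D x\<close> one after the other multiplies the number of these traces by at least \<open>\<beta>\<close> each
  time, by the induction hypothesis. So \<open>x\<close> destroys at most a fraction
  \<open>card (bad x) / \<beta> ^ (card (D x) - 1)\<close> of the old count, and the weight condition leaves a factor \<open>\<beta>\<close>.\<close>

lemma card_avoiding_insert_ge:
  fixes \<beta> :: real
  assumes "finite I" "finite X" "\<beta> > 0"
    and bad: "\<And>x. x \<in> X \<Longrightarrow> finite (bad x)"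
    and weight: "\<And>v. v \<in> I \<Longrightarrow>
      \<beta> + (\<Sum>x | x \<in> X \<and> v \<in> D x. real (card (bad x)) / \<beta> ^ (card (D x) - 1)) \<le> 2"
    and "S \<subseteq> I" "v \<in> I - S"
  shows "\<beta> * card (avoiding X D bad S) \<le> card (avoiding X D bad (insert v S))"
  using assms(6,7)
proof (induction "card S" arbitrary: S v rule: less_induct)
  case less
  let ?good = "avoiding X D bad"
  have finS: "finite S"
    using less.prems(1) assms(1) finite_subset by blast
  have fin_good: "finite (?good U)" if "finite U" for U
    using that by (auto simp: avoiding_def)
  have chain: "\<beta> ^ card W * card (?good U) \<le> card (?good (U \<union> W))"
    if "finite W" "U \<inter> W = {}" "U \<union> W \<subseteq> S" for U W
    using that
  proof (induction W rule: finite_induct)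
    case (insert w W)
    have "U \<union> W \<subset> S"
      using insert by auto
    then have "card (U \<union> W) < card S"
      using finS psubset_card_mono by blast
    then have "\<beta> * card (?good (U \<union> W)) \<le> card (?good (insert w (U \<union> W)))"
      using insert less.prems(1) by (intro less.hyps) auto
    moreover have "\<beta> * (\<beta> ^ card W * card (?good U)) \<le> \<beta> * card (?good (U \<union> W))"
      using insert assms(3) by (intro mult_left_mono) auto
    ultimately show ?case
      using insert by (simp add: algebra_simps)
  qed simp
  \<comment> \<open>the candidates before the events at \<open>v\<close> are taken into account\<close>
  define ext where "ext = {A \<in> Pow (insert v S). A - {v} \<in> ?good S}"
  define Y where "Y = {x \<in> X. v \<in> D x \<and> D x \<subseteq> insert v S}"
  define B where "B x = {A \<in> ext. A \<inter> D x \<in> bad x}" for x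
  have fin: "finite Y" "finite ext"
    using assms(2) finS by (auto simp: Y_def ext_def)
  have vS: "v \<notin> S"
    using less.prems(2) by simp
  have "ext = ?good S \<union> insert v ` ?good S"
  proof (intro equalityI subsetI)
    fix A assume A: "A \<in> ext"
    show "A \<in> ?good S \<union> insert v ` ?good S"
    proof (cases "v \<in> A")
      case True
      then have "A = insert v (A - {v})" by auto
      moreover have "A - {v} \<in> ?good S"
        using A by (simp add: ext_def)
      ultimately show ?thesis by blast
    next
      case False
      then have "A - {v} = A" by auto
      with A show ?thesis by (simp add: ext_def)
    qed
  next
    fix A assume "A \<in> ?good S \<union> insert v ` ?good S"
    then show "A \<in> ext"
    proof
      assume A: "A \<in> ?good S"
      then have "A - {v} = A" using vS by (auto simp: avoiding_def)
      with A show ?thesis by (auto simp: ext_def avoiding_def)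
    next
      assume "A \<in> insert v ` ?good S"
      then obtain A' where A': "A' \<in> ?good S" "A = insert v A'" by auto
      then have "A - {v} = A'" using vS by (auto simp: avoiding_def)
      with A' show ?thesis by (auto simp: ext_def avoiding_def)
    qed
  qed
  moreover have "card (insert v ` ?good S) = card (?good S)"
    using vS by (intro card_image inj_onI) (auto simp: avoiding_def)
  moreover have "?good S \<inter> insert v ` ?good S = {}"
    using vS by (auto simp: avoiding_def)
  ultimately have card_ext: "card ext = 2 * card (?good S)"
    using fin_good[OF finS] by (simp add: card_Un_disjoint)
  have card_B: "real (card (B x)) \<le> card (bad x) / \<beta> ^ (card (D x) - 1) * card (?good S)"
    if x: "x \<in> Y" for x
  proof -
    have xX: "x \<in> X" "v \<in> D x" "D x \<subseteq> insert v S"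
      using x by (auto simp: Y_def)
    have "card (B x) \<le> card (bad x \<times> ?good (S - D x))"
    proof (rule card_inj_on_le[where f = "\<lambda>A. (A \<inter> D x, A - D x)"])
      show "inj_on (\<lambda>A. (A \<inter> D x, A - D x)) (B x)"
        by (auto simp: inj_on_def)
      show "finite (bad x \<times> ?good (S - D x))"
        using bad xX finS fin_good by simp
      show "(\<lambda>A. (A \<inter> D x, A - D x)) ` B x \<subseteq> bad x \<times> ?good (S - D x)"
      proof (intro image_subsetI SigmaI)
        fix A assume A: "A \<in> B x"
        then show "A \<inter> D x \<in> bad x" by (simp add: B_def)
        have "(A - D x) \<inter> D y \<notin> bad y" if "y \<in> X" "D y \<subseteq> S - D x" for y
        proof -
          have "(A - D x) \<inter> D y = (A - {v}) \<inter> D y"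
            using that xX(2) by auto
          then show ?thesis
            using A that by (auto simp: B_def ext_def avoiding_def)
        qed
        moreover have "A - D x \<subseteq> S - D x"
          using A xX by (auto simp: B_def ext_def)
        ultimately show "A - D x \<in> ?good (S - D x)"
          by (auto simp: avoiding_def)
      qed
    qed
    then have 1: "real (card (B x)) \<le> card (bad x) * card (?good (S - D x))"
      by (simp add: card_cartesian_product flip: of_nat_mult)
    have "S \<inter> D x = D x - {v}"
      using xX vS by auto
    then have "card (S \<inter> D x) = card (D x) - 1"
      using xX by simp
    moreover have "(S - D x) \<union> (S \<inter> D x) = S"
      by auto
    moreover have "\<beta> ^ card (S \<inter> D x) * card (?good (S - D x)) \<le> card (?good ((S - D x) \<union> (S \<inter> D x)))"
      using finS by (intro chain) auto
    ultimately have "\<beta> ^ (card (D x) - 1) * card (?good (S - D x)) \<le> card (?good S)"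
      by metis
    then have "real (card (?good (S - D x))) \<le> card (?good S) / \<beta> ^ (card (D x) - 1)"
      using assms(3) by (simp add: field_simps)
    then have "card (bad x) * real (card (?good (S - D x)))
        \<le> card (bad x) * (card (?good S) / \<beta> ^ (card (D x) - 1))"
      by (intro mult_left_mono) auto
    with 1 show ?thesis by simp
  qed
  have "ext - (\<Union>x\<in>Y. B x) \<subseteq> ?good (insert v S)"
  proof
    fix A assume A: "A \<in> ext - (\<Union>x\<in>Y. B x)"
    have "A \<inter> D x \<notin> bad x" if x: "x \<in> X" "D x \<subseteq> insert v S" for x
    proof (cases "v \<in> D x")
      case True
      then show ?thesis using A x by (auto simp: Y_def B_def)
    next
      case False
      then have "A \<inter> D x = (A - {v}) \<inter> D x" "D x \<subseteq> S"
        using x by auto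
      then show ?thesis using A x by (auto simp: ext_def avoiding_def)
    qed
    with A show "A \<in> ?good (insert v S)"
      by (auto simp: avoiding_def ext_def)
  qed
  then have "card (ext - (\<Union>x\<in>Y. B x)) \<le> card (?good (insert v S))"
    using fin_good finS by (intro card_mono) auto
  moreover have "card ext - card (\<Union>x\<in>Y. B x) \<le> card (ext - (\<Union>x\<in>Y. B x))"
    using fin by (intro diff_card_le_card_Diff) (auto simp: B_def)
  moreover have "card (\<Union>x\<in>Y. B x) \<le> (\<Sum>x\<in>Y. card (B x))"
    using fin by (intro card_UN_le)
  ultimately have "real (card ext) \<le> card (?good (insert v S)) + (\<Sum>x\<in>Y. real (card (B x)))"
    by (simp flip: of_nat_sum of_nat_add)
  moreover have "(\<Sum>x\<in>Y. real (card (B x))) \<le> (2 - \<beta>) * card (?good S)"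
  proof -
    have "(\<Sum>x\<in>Y. real (card (B x)))
        \<le> (\<Sum>x\<in>Y. card (bad x) / \<beta> ^ (card (D x) - 1) * card (?good S))"
      by (intro sum_mono card_B)
    also have "\<dots> = (\<Sum>x\<in>Y. card (bad x) / \<beta> ^ (card (D x) - 1)) * card (?good S)"
      by (simp add: sum_distrib_right)
    also have "\<dots> \<le> (\<Sum>x | x \<in> X \<and> v \<in> D x. card (bad x) / \<beta> ^ (card (D x) - 1)) * card (?good S)"
      using assms(2,3) by (intro mult_right_mono sum_mono2) (auto simp: Y_def)
    also have "\<dots> \<le> (2 - \<beta>) * card (?good S)"
      using weight[of v] less.prems(2) by (intro mult_right_mono) auto
    finally show ?thesis .
  qed
  ultimately show ?case
    using card_ext by (simp add: algebra_simps)
qed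

theorem ex_avoiding_all:
  fixes \<beta> :: real
  assumes "finite I" "finite X" "\<beta> > 0"
    and bad: "\<And>x. x \<in> X \<Longrightarrow> finite (bad x)"
    and D: "\<And>x. x \<in> X \<Longrightarrow> D x \<noteq> {} \<and> D x \<subseteq> I"
    and weight: "\<And>v. v \<in> I \<Longrightarrow>
      \<beta> + (\<Sum>x | x \<in> X \<and> v \<in> D x. real (card (bad x)) / \<beta> ^ (card (D x) - 1)) \<le> 2"
  shows "\<exists>A\<subseteq>I. \<forall>x\<in>X. A \<inter> D x \<notin> bad x"
proof -
  have "card (avoiding X D bad S) > 0" if "S \<subseteq> I" for S
    using finite_subset[OF that assms(1)] that
  proof (induction S rule: finite_induct)
    case empty
    have "\<not> D x \<subseteq> {}" if "x \<in> X" for x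
      using D[OF that] by simp
    then have "avoiding X D bad {} = {{}}"
      by (simp add: avoiding_def)
    then show ?case by simp
  next
    case (insert v S)
    have "\<beta> * card (avoiding X D bad S) \<le> card (avoiding X D bad (insert v S))"
    proof (rule card_avoiding_insert_ge[where I = I])
      show "S \<subseteq> I" "v \<in> I - S"
        using insert.prems insert.hyps(2) by blast+
    qed (fact assms(1-3) bad weight)+
    moreover have "\<beta> * card (avoiding X D bad S) > 0"
      using insert.IH insert.prems assms(3) by (intro mult_pos_pos) auto
    ultimately show ?case by linarith
  qed
  from this[of I] have "avoiding X D bad I \<noteq> {}"
    by (metis card.empty order.refl less_irrefl)
  then obtain A where "A \<in> avoiding X D bad I"
    by blast
  moreover have "D x \<subseteq> I" if "x \<in> X" for x
    using D[OF that] by simp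
  ultimately show ?thesis
    by (intro exI[of _ A] conjI ballI) (simp_all add: avoiding_def)
qed

section \<open>Choosing the sides of the matching edges\<close>

lemma sum_power_card_Pow:
  fixes x :: "'a :: comm_semiring_1"
  assumes "finite J"
  shows "(\<Sum>B\<in>Pow J. x ^ card B) = (1 + x) ^ card J"
  using assms
proof (induction J rule: finite_induct)
  case (insert j J)
  have inj: "inj_on (insert j) (Pow J)"
    using insert by (auto simp: inj_on_def)
  have "(\<Sum>B\<in>Pow (insert j J). x ^ card B)
      = (\<Sum>B\<in>Pow J. x ^ card B) + (\<Sum>B\<in>insert j ` Pow J. x ^ card B)"
    using insert unfolding Pow_insert by (intro sum.union_disjoint) auto
  also have "(\<Sum>B\<in>insert j ` Pow J. x ^ card B) = (\<Sum>B\<in>Pow J. x * x ^ card B)"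
    using insert by (subst sum.reindex[OF inj], intro sum.cong)
      (auto simp: card_insert_if finite_subset subset_iff)
  finally show ?case
    using insert by (simp add: sum_distrib_left[symmetric] algebra_simps)
qed simp

text \<open>The exponential moment bound for a lower binomial tail: each counted set has weight
  \<open>x ^ card B \<ge> x ^ t\<close>.\<close>

lemma card_small_subsets_le:
  fixes x :: real
  assumes "finite J" "0 < x" "x \<le> 1"
  shows "x ^ t * card {B. B \<subseteq> J \<and> card B \<le> t} \<le> (1 + x) ^ card J"
proof -
  let ?S = "{B. B \<subseteq> J \<and> card B \<le> t}"
  have "x ^ t * card ?S = (\<Sum>B\<in>?S. x ^ t)"
    by simp
  also have "\<dots> \<le> (\<Sum>B\<in>?S. x ^ card B)"
    using assms by (intro sum_mono power_decreasing) auto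
  also have "\<dots> \<le> (\<Sum>B\<in>Pow J. x ^ card B)"
    using assms by (intro sum_mono2) auto
  finally show ?thesis
    using sum_power_card_Pow[OF assms(1), of x] by simp
qed

text \<open>Raising \<open>q\<close> by one multiplies the left-hand side by \<open>9 * 32 * 33 ^ 10\<close> and by at most \<open>24 / 14 = 12 / 7\<close>
  from the linear factor, which together is less than the factor \<open>64 ^ 10\<close> on the right.\<close>

lemma few_subsets_power_bound:
  "3 * 9 ^ (q + 2) * (10 * q + 14) * 32 ^ q * 33 ^ (10 * q + 13) \<le> (64 :: nat) ^ (10 * q + 13)"
proof (induction q)
  case (Suc q)
  let ?a = "3 * 9 ^ (q + 2) * 32 ^ q * 33 ^ (10 * q + 13) :: nat"
  have "7 * (3 * 9 ^ (Suc q + 2) * (10 * Suc q + 14) * 32 ^ Suc q * 33 ^ (10 * Suc q + 13))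
      = ?a * (7 * (10 * q + 24)) * (9 * 32 * 33 ^ 10)"
    by (simp add: power_add algebra_simps)
  also have "\<dots> \<le> ?a * (12 * (10 * q + 14)) * (9 * 32 * 33 ^ 10)"
    by (intro mult_le_mono1 mult_le_mono2) simp
  also have "\<dots> = (?a * (10 * q + 14)) * (12 * 9 * 32 * 33 ^ 10)"
    by simp
  also have "\<dots> \<le> 64 ^ (10 * q + 13) * (7 * 64 ^ 10)"
  proof (rule mult_le_mono)
    show "?a * (10 * q + 14) \<le> 64 ^ (10 * q + 13)"
      using Suc.IH by (simp only: mult_ac)
  qed simp
  also have "\<dots> = 7 * 64 ^ (10 * Suc q + 13)"
    by (simp add: power_add)
  finally show ?case
    by (rule mult_left_le_imp_le) simp
qed simp

text \<open>The numerical heart of the weight condition. The tail bound is taken at \<open>x = 1 / 32\<close>: a much smaller \<open>x\<close>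
  would lose too much in the power \<open>x ^ q\<close> for large \<open>q\<close>, while a much larger \<open>x\<close> would be too weak at \<open>q = 0\<close>,
  where only the empty set is counted.\<close>

lemma card_few_subsets_le:
  assumes "finite J" "card J = 10 * q + 13"
  shows "3 * 9 ^ (q + 2) * real (10 * q + 14) * card {B. B \<subseteq> J \<and> card B \<le> q} \<le> 2 ^ (10 * q + 13)"
proof -
  let ?N = "10 * q + 13"
  define c where "c = real (card {B. B \<subseteq> J \<and> card B \<le> q})"
  have "(1/32) ^ q * c \<le> (33/32 :: real) ^ ?N"
    using card_small_subsets_le[of J "1/32" q] assms by (simp add: c_def)
  then have c: "c * 32 ^ ?N \<le> 32 ^ q * 33 ^ ?N"
    by (simp add: power_divide field_simps)
  have "real (3 * 9 ^ (q + 2) * (10 * q + 14) * 32 ^ q * 33 ^ ?N) \<le> real (64 ^ ?N)"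
    using few_subsets_power_bound of_nat_le_iff by blast
  then have num: "3 * 9 ^ (q + 2) * real (10 * q + 14) * (32 ^ q * 33 ^ ?N) \<le> 64 ^ ?N"
    by (simp add: mult_ac)
  have "(3 * 9 ^ (q + 2) * real (10 * q + 14) * c) * 32 ^ ?N
      = (3 * 9 ^ (q + 2) * real (10 * q + 14)) * (c * 32 ^ ?N)"
    by (simp only: mult.assoc)
  also have "\<dots> \<le> (3 * 9 ^ (q + 2) * real (10 * q + 14)) * (32 ^ q * 33 ^ ?N)"
    by (rule mult_left_mono[OF c]) simp
  also have "\<dots> \<le> 64 ^ ?N" by (rule num)
  also have "(64 :: real) ^ ?N = 2 ^ ?N * 32 ^ ?N"
    by (simp flip: power_mult_distrib)
  finally show ?thesis
    unfolding c_def by simp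
qed

text \<open>A pair \<open>(i, s)\<close> is an end of the \<open>i\<close>th matching edge, and \<open>A\<close> consists of the edges at which the end
  \<open>(i, True)\<close> is put on the left, the other end being put on the right. Each left end must see
  many right ends of other edges. For each end, fix \<open>N = 10 * q + 13\<close> edges that it sees and one seen
  end of each. The bad event is that this end is on the left while at most \<open>q\<close> of the fixed ends are on
  the right. It involves \<open>N + 1\<close> edges, and each edge is involved in at most \<open>2 * m\<close> events, so the
  local lemma applies with \<open>\<beta> = 2 * N / (N + 1)\<close>, the factor 2 being reduced by the reciprocal of the
  number of coordinates of an event.\<close>

lemma ex_endpoint_choice:
  fixes R :: "'i \<times> bool \<Rightarrow> 'i \<times> bool \<Rightarrow> bool"
  assumes "finite I" "m \<le> 9 ^ (q + 2)"
    and many: "\<And>i s. i \<in> I \<Longrightarrow> 10 * q + 13 \<le> card {j \<in> I - {i}. \<exists>t. R (i, s) (j, t)}"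
    and few: "\<And>j. j \<in> I \<Longrightarrow>
      card {(i, s). i \<in> I \<and> (i = j \<or> (\<exists>t. R (i, s) (j, t)))} \<le> 2 * m"
  shows "\<exists>A\<subseteq>I. \<forall>i\<in>I. q < card {j \<in> I - {i}. R (i, i \<in> A) (j, j \<notin> A)}"
proof -
  define N where "N = 10 * q + 13"
  define X where "X = I \<times> (UNIV :: bool set)"
  have "\<forall>x\<in>X. \<exists>J. J \<subseteq> {j \<in> I - {fst x}. \<exists>t. R x (j, t)} \<and> card J = N"
  proof
    fix x assume "x \<in> X"
    then have "N \<le> card {j \<in> I - {fst x}. \<exists>t. R x (j, t)}"
      using many[of "fst x" "snd x"] by (simp add: X_def N_def mem_Times_iff)
    then show "\<exists>J. J \<subseteq> {j \<in> I - {fst x}. \<exists>t. R x (j, t)} \<and> card J = N"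
      by (meson obtain_subset_with_card_n)
  qed
  from bchoice[OF this] obtain J where
    "\<forall>x\<in>X. J x \<subseteq> {j \<in> I - {fst x}. \<exists>t. R x (j, t)} \<and> card (J x) = N"
    by blast
  then have J: "J x \<subseteq> {j \<in> I - {fst x}. \<exists>t. R x (j, t)}" "card (J x) = N" if "x \<in> X" for x
    using that by blast+
  have finJ: "finite (J x)" if "x \<in> X" for x
    by (rule finite_subset[OF J(1)[OF that]]) (use assms(1) in simp)
  define side where "side x j = (SOME t. R x (j, t))" for x j
  have side: "R x (j, side x j)" if "x \<in> X" "j \<in> J x" for x j
  proof -
    have "\<exists>t. R x (j, t)"
      using J(1)[OF that(1)] that(2) by blast
    then show ?thesis
      unfolding side_def by (rule someI_ex)
  qed
  define D where "D x = insert (fst x) (J x)" for x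
  define hit where "hit x B = {j \<in> J x. (j \<notin> B) = side x j}" for x B
  define bad where "bad x = {B \<in> Pow (D x). (fst x \<in> B) = snd x \<and> card (hit x B) \<le> q}" for x
  define \<beta> where "\<beta> = 2 * real N / (N + 1)"
  have N: "N > 0" by (simp add: N_def)
  have card_D: "card (D x) = N + 1" if "x \<in> X" for x
    using J[OF that] finJ[OF that] by (auto simp: D_def card_insert_if)
  have card_bad: "3 * m * (N + 1) * real (card (bad x)) \<le> 2 ^ N" if x: "x \<in> X" for x
  proof -
    let ?small = "{B. B \<subseteq> J x \<and> card B \<le> q}"
    \<comment> \<open>Which edges are hit determines a bad pattern on \<open>J x\<close>, and its value at \<open>fst x\<close> is prescribed.\<close>
    have "card (bad x) \<le> card ?small"
    proof (rule card_inj_on_le[where f = "hit x"])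
      show "inj_on (hit x) (bad x)"
      proof (rule inj_onI)
        fix B B' assume B: "B \<in> bad x" "B' \<in> bad x" and eq: "hit x B = hit x B'"
        have "j \<in> B \<longleftrightarrow> j \<in> B'" if "j \<in> D x" for j
        proof (cases "j \<in> J x")
          case True
          then have "j \<in> hit x B \<longleftrightarrow> (j \<notin> B) = side x j" "j \<in> hit x B' \<longleftrightarrow> (j \<notin> B') = side x j"
            by (auto simp: hit_def)
          with eq show ?thesis by auto
        next
          case False
          with that B show ?thesis by (auto simp: D_def bad_def)
        qed
        with B show "B = B'" by (auto simp: bad_def)
      qed
      show "hit x ` bad x \<subseteq> ?small"
        by (auto simp: bad_def hit_def)
      show "finite ?small"
        using finJ[OF x] by simp
    qed
    moreover have "real m \<le> 9 ^ (q + 2)"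
      using assms(2) by (simp flip: of_nat_le_iff[where 'a = real])
    ultimately have "(3 * (N + 1)) * (m * real (card (bad x)))
        \<le> (3 * (N + 1)) * (9 ^ (q + 2) * real (card ?small))"
      by (intro mult_left_mono mult_mono) auto
    also have "\<dots> = 3 * 9 ^ (q + 2) * real (10 * q + 14) * card ?small"
      by (simp add: N_def)
    also have "\<dots> \<le> 2 ^ N"
      using card_few_subsets_le[OF finJ[OF x]] J(2)[OF x] by (simp add: N_def)
    finally show ?thesis by (simp add: algebra_simps)
  qed
  \<comment> \<open>replacing \<open>\<beta> ^ N\<close> by \<open>2 ^ N\<close> costs at most a factor \<open>exp 1 \<le> 3\<close>\<close>
  have "(1 + 1 / real N) ^ N \<le> exp (1 / N) ^ N"
    using exp_ge_add_one_self[of "1 / N"] by (intro power_mono) auto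
  also have "\<dots> = exp 1"
    using N by (simp flip: exp_of_nat_mult)
  also have "\<dots> \<le> 3" by (rule exp_le)
  finally have "2 ^ N \<le> 3 * (2 ^ N / (1 + 1 / real N) ^ N)"
    using N by (simp add: divide_simps)
  also have "2 ^ N / (1 + 1 / real N) ^ N = \<beta> ^ N"
    unfolding power_divide[symmetric] \<beta>_def using N by (simp add: field_simps)
  finally have \<beta>N: "2 ^ N \<le> 3 * \<beta> ^ N" .
  have \<beta>: "\<beta> > 0" using N by (simp add: \<beta>_def)
  have weight: "\<beta> + (\<Sum>x | x \<in> X \<and> v \<in> D x. real (card (bad x)) / \<beta> ^ (card (D x) - 1)) \<le> 2"
    if v: "v \<in> I" for v
  proof -
    let ?F = "{(i, s). i \<in> I \<and> (i = v \<or> (\<exists>t. R (i, s) (v, t)))}"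
    have finF: "finite ?F"
      by (rule finite_subset[of _ "I \<times> UNIV"]) (use assms(1) in auto)
    moreover have "(v, True) \<in> ?F"
      using v by simp
    ultimately have "card ?F > 0"
      by (simp only: card_gt_0_iff) blast
    with few[OF v] have m: "m > 0"
      by linarith
    have "real (card (bad x)) / \<beta> ^ (card (D x) - 1) \<le> 1 / (m * (N + 1))" if "x \<in> X" for x
    proof -
      define K where "K = real m * (N + 1)"
      have K: "K > 0"
        using m by (simp add: K_def)
      have "3 * (real (card (bad x)) * K) = 3 * m * (N + 1) * real (card (bad x))"
        by (simp add: K_def algebra_simps)
      also have "\<dots> \<le> 3 * \<beta> ^ N"
        using card_bad[OF that] \<beta>N by (rule order.trans)
      finally have "real (card (bad x)) / \<beta> ^ N \<le> 1 / K"
        using K \<beta> by (simp add: divide_simps mult.commute)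
      then show ?thesis
        using card_D[OF that] by (simp add: K_def algebra_simps)
    qed
    then have "(\<Sum>x | x \<in> X \<and> v \<in> D x. real (card (bad x)) / \<beta> ^ (card (D x) - 1))
        \<le> card {x \<in> X. v \<in> D x} * (1 / (m * (N + 1)))"
      by (intro sum_bounded_above) auto
    also have "\<dots> \<le> (2 * m) * (1 / (m * (N + 1)))"
    proof (rule mult_right_mono)
      have "{x \<in> X. v \<in> D x} \<subseteq> ?F"
        using J(1) by (fastforce simp: D_def X_def)
      from card_mono[OF finF this] have "card {x \<in> X. v \<in> D x} \<le> 2 * m"
        using few[OF v] by (rule order.trans)
      then show "real (card {x \<in> X. v \<in> D x}) \<le> real (2 * m)"
        by (rule of_nat_mono)
    qed simp
    also have "\<dots> = 2 / (N + 1)"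
      using m by (simp only: of_nat_mult of_nat_numeral times_divide_eq_right mult_1_right mult.commute[of 2])
        (rule mult_divide_mult_cancel_left, simp)
    also have "\<dots> = 2 - \<beta>"
      by (simp add: \<beta>_def field_simps)
    finally show ?thesis by simp
  qed
  have "finite X"
    using assms(1) by (simp add: X_def)
  moreover have "finite (bad x)" if "x \<in> X" for x
    using finJ[OF that] by (simp add: bad_def D_def)
  moreover have "D x \<noteq> {} \<and> D x \<subseteq> I" if "x \<in> X" for x
    using J(1)[OF that] that by (auto simp: D_def X_def)
  ultimately obtain A where A: "A \<subseteq> I" "\<And>x. x \<in> X \<Longrightarrow> A \<inter> D x \<notin> bad x"
    using ex_avoiding_all[of I X \<beta> bad D] assms(1) \<beta> weight by blast
  have "q < card {j \<in> I - {i}. R (i, i \<in> A) (j, j \<notin> A)}" if i: "i \<in> I" for i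
  proof -
    let ?x = "(i, i \<in> A)"
    have x: "?x \<in> X" using i by (simp add: X_def)
    have "A \<inter> D ?x \<notin> bad ?x"
      using A(2) x by blast
    moreover have "i \<in> A \<inter> D ?x \<longleftrightarrow> i \<in> A"
      by (simp add: D_def)
    ultimately have "q < card (hit ?x (A \<inter> D ?x))"
      by (auto simp: bad_def)
    also have "\<dots> \<le> card {j \<in> I - {i}. R ?x (j, j \<notin> A)}"
    proof (rule card_mono)
      show "hit ?x (A \<inter> D ?x) \<subseteq> {j \<in> I - {i}. R ?x (j, j \<notin> A)}"
      proof
        fix j assume "j \<in> hit ?x (A \<inter> D ?x)"
        then have "j \<in> J ?x" "(j \<notin> A) = side ?x j"
          by (auto simp: hit_def D_def)
        then show "j \<in> {j \<in> I - {i}. R ?x (j, j \<notin> A)}"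
          using side[OF x, of j] J(1)[OF x] by auto
      qed
    qed (use assms(1) in simp)
    finally show ?thesis .
  qed
  with A(1) show ?thesis by blast
qed

section \<open>From matchings to transversals\<close>

definition neighbours :: "'a ugraph \<Rightarrow> 'a \<Rightarrow> 'a set" where
  "neighbours G u = {w. {u, w} \<in> edges G}"

lemma card_neighbours:
  assumes "simple_graph G"
  shows "card (neighbours G u) = vertex_degree G u"
  unfolding vertex_degree_def
proof (rule bij_betw_same_card[where f = "\<lambda>w. {u, w}"])
  have "\<exists>w. e = {u, w}" if "e \<in> edges G" "u \<in> e" for e
  proof -
    have "card e = 2"
      using assms that(1) by (simp add: simple_graph_def)
    then obtain x y where "e = {x, y}"
      by (auto simp: card_2_iff)
    with that(2) show ?thesis
      by (cases "u = x") auto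
  qed
  then show "bij_betw (\<lambda>w. {u, w}) (neighbours G u) {e \<in> edges G. u \<in> e}"
    by (auto simp: bij_betw_def inj_on_def neighbours_def doubleton_eq_iff image_iff)
qed

lemma neighbours_subset:
  assumes "simple_graph G"
  shows "neighbours G u \<subseteq> vertices G - {u}"
  using assms by (fastforce simp: simple_graph_def neighbours_def)

lemma finite_pm_transversals:
  assumes "simple_graph G"
  shows "finite (pm_transversals G n \<G>)"
proof -
  have "finite (edges G)"
    using assms by (auto simp: simple_graph_def intro: finite_subset[of _ "Pow (vertices G)"])
  then have "finite (SIGMA T:Pow (edges G). T \<rightarrow>\<^sub>E {1..n})"
    by (intro finite_SigmaI finite_PiE) (auto intro: finite_subset)
  moreover have "pm_transversals G n \<G> \<subseteq> (SIGMA T:Pow (edges G). T \<rightarrow>\<^sub>E {1..n})"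
    by (auto simp: pm_transversals_def is_transversal_def PiE_def bij_betw_def)
  ultimately show ?thesis
    using finite_subset by blast
qed

text \<open>A permutation \<open>\<sigma>\<close> gives colour \<open>i\<close> to the edge joining \<open>a i\<close> to \<open>b (\<sigma> i)\<close>. It can be read off from
  the resulting pair: as the classes are disjoint, \<open>b (\<sigma> i)\<close> is the right end of the edge of
  colour \<open>i\<close>.\<close>

lemma card_representatives_le_card_pm_transversals:
  fixes a b :: "nat \<Rightarrow> 'a"
  assumes "simple_graph G"
    and "\<And>i. i \<in> {1..n} \<Longrightarrow> edges (\<G> i) \<subseteq> edges G"
    and inj: "inj_on a {1..n}" "inj_on b {1..n}"
    and disj: "a ` {1..n} \<inter> b ` {1..n} = {}" and cover: "a ` {1..n} \<union> b ` {1..n} = vertices G"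
  shows "card (representatives (\<lambda>i. {j \<in> {1..n}. {a i, b j} \<in> edges (\<G> i)}) {1..n} {1..n})
    \<le> card (pm_transversals G n \<G>)"
    (is "card ?S \<le> _")
proof (rule card_inj_on_le)
  let ?I = "{1..n}"
  define edge where "edge \<sigma> i = {a i, b (\<sigma> i)}" for \<sigma> i
  define tr where "tr \<sigma> = (edge \<sigma> ` ?I, restrict (inv_into ?I (edge \<sigma>)) (edge \<sigma> ` ?I))" for \<sigma>
  have \<sigma>I: "\<sigma> i \<in> ?I" "{a i, b (\<sigma> i)} \<in> edges (\<G> i)" if "\<sigma> \<in> ?S" "i \<in> ?I" for \<sigma> i
    using that by (auto simp: representatives_def PiE_iff)
  have ab: "a i \<noteq> b j" if "i \<in> ?I" "j \<in> ?I" for i j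
    using disj that by blast
  have edge_disj: "edge \<sigma> i \<inter> edge \<sigma> j = {}" if "\<sigma> \<in> ?S" "i \<in> ?I" "j \<in> ?I" "i \<noteq> j" for \<sigma> i j
  proof -
    have "inj_on \<sigma> ?I"
      using that(1) by (auto simp: representatives_def bij_betw_def)
    then have "\<sigma> i \<noteq> \<sigma> j"
      using that(2-4) by (metis inj_onD)
    moreover have "\<sigma> i \<in> ?I" "\<sigma> j \<in> ?I"
      using \<sigma>I(1)[OF that(1)] that(2,3) by blast+
    ultimately have "a i \<noteq> a j" "b (\<sigma> i) \<noteq> b (\<sigma> j)" "a i \<noteq> b (\<sigma> j)" "a j \<noteq> b (\<sigma> i)"
      using inj ab that(2-4) by (metis inj_onD)+
    then show ?thesis
      by (auto simp: edge_def)
  qed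
  then have inj_edge: "inj_on (edge \<sigma>) ?I" if "\<sigma> \<in> ?S" for \<sigma>
    using that by (fastforce simp: inj_on_def edge_def)
  show "inj_on tr ?S"
  proof (rule inj_onI)
    fix \<sigma> \<tau> assume \<sigma>: "\<sigma> \<in> ?S" and \<tau>: "\<tau> \<in> ?S" and eq: "tr \<sigma> = tr \<tau>"
    have "\<sigma> i = \<tau> i" if i: "i \<in> ?I" for i
    proof -
      have "edge \<sigma> ` ?I = edge \<tau> ` ?I"
        using eq by (simp add: tr_def)
      then have "edge \<sigma> i \<in> edge \<tau> ` ?I"
        using i by blast
      then obtain j where j: "j \<in> ?I" "edge \<sigma> i = edge \<tau> j" by auto
      have "i = inv_into ?I (edge \<sigma>) (edge \<sigma> i)"
        using inj_edge[OF \<sigma>] i by simp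
      also have "\<dots> = snd (tr \<sigma>) (edge \<sigma> i)"
        using i by (simp add: tr_def)
      also have "\<dots> = snd (tr \<tau>) (edge \<tau> j)"
        using eq j by simp
      also have "\<dots> = j"
        using inj_edge[OF \<tau>] j by (simp add: tr_def)
      finally have "b (\<sigma> i) = b (\<tau> i)"
        using j by (auto simp: edge_def doubleton_eq_iff)
      then show ?thesis
        using inj_onD[OF inj(2)] \<sigma>I(1)[OF \<sigma> i] \<sigma>I(1)[OF \<tau> i] by blast
    qed
    moreover have "\<sigma> \<in> extensional ?I" "\<tau> \<in> extensional ?I"
      using \<sigma> \<tau> by (auto simp: representatives_def PiE_def)
    ultimately show "\<sigma> = \<tau>"
      by (metis extensionalityI)
  qed
  show "tr ` ?S \<subseteq> pm_transversals G n \<G>"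
  proof (rule image_subsetI)
    fix \<sigma> assume \<sigma>: "\<sigma> \<in> ?S"
    have "edge \<sigma> i \<in> edges (\<G> i)" if "i \<in> ?I" for i
      using \<sigma>I(2)[OF \<sigma> that] by (simp add: edge_def)
    moreover from this have sub: "edge \<sigma> ` ?I \<subseteq> edges G"
      using assms(2) by blast
    moreover have "bij_betw (restrict (inv_into ?I (edge \<sigma>)) (edge \<sigma> ` ?I)) (edge \<sigma> ` ?I) ?I"
      using bij_betw_inv_into[OF inj_on_imp_bij_betw[OF inj_edge[OF \<sigma>]]] by simp
    moreover have "inv_into ?I (edge \<sigma>) (edge \<sigma> i) = i" if "i \<in> ?I" for i
      using inj_edge[OF \<sigma>] that by (rule inv_into_f_f)
    ultimately have "is_transversal G n \<G> (tr \<sigma>)"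
      unfolding is_transversal_def tr_def prod.case by simp
    moreover have "\<Union>(edge \<sigma> ` ?I) = vertices G"
    proof -
      have "\<sigma> ` ?I = ?I"
        using \<sigma> by (auto simp: representatives_def bij_betw_def)
      then have "b ` ?I = (\<lambda>i. b (\<sigma> i)) ` ?I"
        by (metis image_image)
      then show ?thesis
        unfolding cover[symmetric] by (auto simp: edge_def)
    qed
    moreover have "disjoint (edge \<sigma> ` ?I)"
      using edge_disj[OF \<sigma>] by (auto simp: disjoint_def simp del: atLeastAtMost_iff)
    ultimately show "tr \<sigma> \<in> pm_transversals G n \<G>"
      using sub by (simp add: pm_transversals_def perfect_matching_def tr_def)
  qed
  show "finite (pm_transversals G n \<G>)"
    by (rule finite_pm_transversals[OF assms(1)])
qed

lemma pm_transversal_endpoints: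
  assumes "simple_graph G" "(T, \<phi>) \<in> pm_transversals G n \<G>"
  obtains ends :: "nat \<times> bool \<Rightarrow> 'a"
  where "bij_betw ends ({1..n} \<times> UNIV) (vertices G)"
    "\<And>i. i \<in> {1..n} \<Longrightarrow> {ends (i, True), ends (i, False)} \<in> edges (\<G> i)"
proof -
  let ?I = "{1..n}"
  define e where "e = inv_into T \<phi>"
  have T: "T \<subseteq> edges G" "bij_betw \<phi> T ?I" "\<forall>f\<in>T. f \<in> edges (\<G> (\<phi> f))" "disjoint T" "\<Union>T = vertices G"
    using assms(2) by (auto simp: pm_transversals_def is_transversal_def perfect_matching_def)
  have e: "bij_betw e ?I T"
    unfolding e_def using T(2) by (rule bij_betw_inv_into)
  have eT: "e i \<in> T" "\<phi> (e i) = i" if "i \<in> ?I" for i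
    using that e T(2) by (auto simp: e_def bij_betw_def f_inv_into_f inv_into_into)
  have "\<exists>x y. e i = {x, y} \<and> x \<noteq> y" if "i \<in> ?I" for i
    using eT(1)[OF that] T(1) assms(1) by (auto simp: simple_graph_def card_2_iff)
  then obtain x y where xy: "\<And>i. i \<in> ?I \<Longrightarrow> e i = {x i, y i} \<and> x i \<noteq> y i"
    by metis
  define ends where "ends = (\<lambda>(i, s). if s then x i else y i)"
  have "inj_on ends (?I \<times> UNIV)"
  proof (rule inj_onI)
    fix p q assume p: "p \<in> ?I \<times> UNIV" and q: "q \<in> ?I \<times> UNIV" and eq: "ends p = ends q"
    have "ends p \<in> e (fst p)" "ends q \<in> e (fst q)"
      using p q xy by (auto simp: ends_def)
    then have "e (fst p) = e (fst q)"
      using T(4) eT p q eq by (metis disjointD disjoint_iff mem_Times_iff)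
    then have "fst p = fst q"
      using e p q by (auto simp: bij_betw_def dest: inj_onD)
    then show "p = q"
      using eq p xy[of "fst p"] by (auto simp: ends_def split: prod.splits if_splits)
  qed
  moreover have "ends ` (?I \<times> UNIV) = \<Union>(e ` ?I)"
    using xy by (fastforce simp: ends_def image_iff UNIV_bool)
  ultimately have "bij_betw ends (?I \<times> UNIV) (vertices G)"
    using e T(5) by (simp add: bij_betw_def)
  moreover have "{ends (i, True), ends (i, False)} \<in> edges (\<G> i)" if "i \<in> ?I" for i
  proof -
    have "e i \<in> edges (\<G> i)"
      using T(3) eT[OF that] by force
    then show ?thesis
      using xy[OF that] by (simp add: ends_def)
  qed
  ultimately show ?thesis using that by blast
qed

section \<open>Many perfect matching transversals\<close>

theorem theorem1p4:
  fixes m n :: nat and G :: "'a ugraph" and \<G> :: "nat \<Rightarrow> 'a ugraph"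
  assumes "m \<ge> 44"
    and "simple_graph G"
    and "card (vertices G) = 2 * n"
    and "max_degree G = m"
    and "\<And>i. i \<in> {1..n} \<Longrightarrow> spanning_subgraph (\<G> i) G"
    and "\<And>i. i \<in> {1..n} \<Longrightarrow> real (min_degree (\<G> i)) \<ge> 10 * ln (real m) + 6"
    and "pm_transversals G n \<G> \<noteq> {}"
  shows "card (pm_transversals G n \<G>) \<ge> fact (nat \<lceil>ln (real m) / 2\<rceil>)"
proof -
  let ?I = "{1..n}"
  define k where "k = nat \<lceil>ln (real m) / 2\<rceil>"
  have exp2: "exp 2 \<le> (9 :: real)"
  proof -
    have "exp 2 = exp (1 :: real) ^ 2"
      by (simp flip: exp_of_nat_mult)
    also have "\<dots> \<le> 3 ^ 2"
      using exp_le by (intro power_mono) auto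
    finally show ?thesis by simp
  qed
  have "ln (exp 2) < ln (real m)"
    using assms(1) exp2 by (subst ln_less_cancel_iff) auto
  then have "ln (real m) > 2"
    by simp
  then have k: "2 \<le> k" "ln (real m) \<le> 2 * k" "2 * real k < ln (real m) + 2"
    unfolding k_def by linarith+
  define q where "q = k - 2"
  have kq: "k = q + 2" using k by (simp add: q_def)
  have "real m = exp (ln (real m))" using assms(1) by simp
  also have "\<dots> \<le> exp (real k * 2)" using k by simp
  also have "\<dots> = exp 2 ^ k" by (rule exp_of_nat_mult)
  also have "\<dots> \<le> 9 ^ k" using exp2 by (intro power_mono) auto
  finally have "real m \<le> real (9 ^ k)" by simp
  then have m9: "m \<le> 9 ^ (q + 2)"
    using kq of_nat_le_iff by blast
  have fin: "finite (vertices G)"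
    using assms(2) by (simp add: simple_graph_def)
  have n: "n > 0"
  proof (rule ccontr)
    assume "\<not> n > 0"
    then have "vertices G = {}" using assms(3) fin by simp
    then show False using assms(1,4) by (simp add: max_degree_def)
  qed
  have max: "card (neighbours G u) \<le> m" if "u \<in> vertices G" for u
    using that fin card_neighbours[OF assms(2), of u] assms(4)[symmetric]
    by (simp add: max_degree_def)
  have simple: "simple_graph (\<G> i)" "edges (\<G> i) \<subseteq> edges G" "vertices (\<G> i) = vertices G" if "i \<in> ?I" for i
    using assms(5)[OF that] by (auto simp: spanning_subgraph_def)
  \<comment> \<open>Rounding up \<open>ln m / 2\<close> loses less than one, so \<open>10 * ln m + 6 > 20 * (k - 1) + 6 = 20 * q + 26\<close>.\<close>
  have min: "20 * q + 27 \<le> card (neighbours (\<G> i) u)" if "i \<in> ?I" "u \<in> vertices G" for i u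
  proof -
    have "min_degree (\<G> i) \<le> vertex_degree (\<G> i) u"
      using that simple[of i] fin by (simp add: min_degree_def)
    moreover have "20 * q + 27 \<le> min_degree (\<G> i)"
    proof -
      have "20 * real q + 26 < real (min_degree (\<G> i))"
        using assms(6)[OF that(1)] k(3) kq by simp
      then show ?thesis by linarith
    qed
    ultimately show ?thesis
      using card_neighbours[OF simple(1)[OF that(1)]] by simp
  qed
  obtain T \<phi> where "(T, \<phi>) \<in> pm_transversals G n \<G>"
    using assms(7) by auto
  then obtain ends where bij: "bij_betw ends (?I \<times> UNIV) (vertices G)"
    and own: "\<And>i. i \<in> ?I \<Longrightarrow> {ends (i, True), ends (i, False)} \<in> edges (\<G> i)"
    using pm_transversal_endpoints[OF assms(2)] by blast
  have endV: "ends (i, s) \<in> vertices G" if "i \<in> ?I" for i s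
    using bij that by (auto simp: bij_betw_def)
  have own': "{ends (i, s), ends (i, \<not> s)} \<in> edges (\<G> i)" if "i \<in> ?I" for i s
    using own[OF that] by (cases s) (auto simp: insert_commute)
  define R where "R p q \<longleftrightarrow> {ends p, ends q} \<in> edges (\<G> (fst p))" for p q
  have "\<exists>A\<subseteq>?I. \<forall>i\<in>?I. q < card {j \<in> ?I - {i}. R (i, i \<in> A) (j, j \<notin> A)}"
  proof (rule ex_endpoint_choice[OF _ m9])
    fix i s assume i: "i \<in> ?I"
    let ?J = "{j \<in> ?I - {i}. \<exists>t. R (i, s) (j, t)}" and ?W = "neighbours (\<G> i) (ends (i, s))"
    \<comment> \<open>every neighbour other than the partner is one of the two ends of an edge counted in \<open>?J\<close>\<close>
    have "?W - {ends (i, \<not> s)} \<subseteq> ends ` (?J \<times> UNIV)"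
    proof
      fix w assume w: "w \<in> ?W - {ends (i, \<not> s)}"
      then have "w \<in> vertices G" "w \<noteq> ends (i, s)"
        using neighbours_subset[OF simple(1)[OF i]] simple(3)[OF i] by auto
      then have "w \<in> ends ` (?I \<times> UNIV)"
        using bij by (simp only: bij_betw_def)
      then obtain j t where jt: "j \<in> ?I" "w = ends (j, t)"
        by blast
      have "j \<noteq> i"
        using jt(2) w \<open>w \<noteq> ends (i, s)\<close> by (cases t; cases s) auto
      moreover have "R (i, s) (j, t)"
        using w jt(2) by (auto simp: R_def neighbours_def)
      ultimately show "w \<in> ends ` (?J \<times> UNIV)"
        using jt by auto
    qed
    then have "card (?W - {ends (i, \<not> s)}) \<le> card (?J \<times> (UNIV :: bool set))"
      by (intro surj_card_le) auto
    moreover have "20 * q + 27 \<le> card ?W"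
      using min i endV by blast
    ultimately show "10 * q + 13 \<le> card ?J"
      by (simp add: card_cartesian_product card_Diff_singleton_if split: if_splits)
  next
    fix j assume j: "j \<in> ?I"
    let ?X = "{(i, s). i \<in> ?I \<and> (i = j \<or> (\<exists>t. R (i, s) (j, t)))}"
    let ?U = "neighbours G (ends (j, True)) \<union> neighbours G (ends (j, False))"
    \<comment> \<open>The two ends of edge \<open>j\<close> itself are also in \<open>?U\<close>, since each is a neighbour of the other.\<close>
    have "card ?X \<le> card ?U"
    proof (rule card_inj_on_le)
      show "inj_on ends ?X"
        by (rule inj_on_subset[OF bij_betw_imp_inj_on[OF bij]]) auto
      show "finite ?U"
        using neighbours_subset[OF assms(2)] fin by (meson finite_Diff finite_UnI finite_subset)
      show "ends ` ?X \<subseteq> ?U"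
      proof
        fix w assume "w \<in> ends ` ?X"
        then obtain i s where w: "w = ends (i, s)" and i: "i \<in> ?I"
          and ij: "i = j \<or> (\<exists>t. R (i, s) (j, t))"
          by blast
        have "\<exists>t. {ends (i, s), ends (j, t)} \<in> edges (\<G> i)"
          using ij own'[OF i, of s] by (auto simp: R_def)
        then obtain t where "{ends (j, t), ends (i, s)} \<in> edges G"
          using simple(2)[OF i] by (auto simp: insert_commute)
        then show "w \<in> ?U"
          unfolding w by (cases t) (auto simp: neighbours_def)
      qed
    qed
    also have "\<dots> \<le> card (neighbours G (ends (j, True))) + card (neighbours G (ends (j, False)))"
      by (rule card_Un_le)
    also have "\<dots> \<le> 2 * m"
      using max[OF endV[OF j, of True]] max[OF endV[OF j, of False]] by simp
    finally show "card ?X \<le> 2 * m" .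
  qed simp
  then obtain A where A: "A \<subseteq> ?I" "\<forall>i\<in>?I. q < card {j \<in> ?I - {i}. R (i, i \<in> A) (j, j \<notin> A)}"
    by blast
  define a where "a i = ends (i, i \<in> A)" for i
  define b where "b i = ends (i, i \<notin> A)" for i
  define N where "N i = {j \<in> ?I. {a i, b j} \<in> edges (\<G> i)}" for i
  have self: "i \<in> N i" if "i \<in> ?I" for i
    using own'[OF that, of "i \<in> A"] that by (simp add: N_def a_def b_def)
  have Nk: "k \<le> card (N i)" if i: "i \<in> ?I" for i
  proof -
    let ?J = "{j \<in> ?I - {i}. R (i, i \<in> A) (j, j \<notin> A)}"
    have "k \<le> card (insert i ?J)"
      using A(2)[rule_format, OF i] kq by (subst card_insert_disjoint) auto
    also have "\<dots> \<le> card (N i)"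
      using self[OF i] by (intro card_mono) (auto simp: N_def R_def a_def b_def)
    finally show ?thesis .
  qed
  have NI: "N i \<subseteq> ?I" for i
    by (auto simp: N_def)
  have "k \<le> card ?I"
    using Nk[of 1] card_mono[OF _ NI[of 1]] n by simp
  moreover have "restrict id ?I \<in> representatives N ?I ?I"
    using self by (auto simp: representatives_def PiE_iff bij_betw_def inj_on_def)
  ultimately have "fact k \<le> card (representatives N ?I ?I)"
    using Nk NI by (intro card_representatives_ge_fact) auto
  also have "\<dots> \<le> card (pm_transversals G n \<G>)"
    unfolding N_def
  proof (rule card_representatives_le_card_pm_transversals)
    show "inj_on a ?I" "inj_on b ?I" "a ` ?I \<inter> b ` ?I = {}"
      using bij by (auto simp: bij_betw_def a_def b_def inj_on_def simp del: atLeastAtMost_iff)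
    show "a ` ?I \<union> b ` ?I = vertices G"
    proof -
      have "a ` ?I \<union> b ` ?I = ends ` (?I \<times> UNIV)"
      proof (intro equalityI subsetI)
        fix w assume "w \<in> ends ` (?I \<times> UNIV)"
        then obtain i s where "i \<in> ?I" "w = ends (i, s)" by auto
        then show "w \<in> a ` ?I \<union> b ` ?I"
          by (cases "s = (i \<in> A)") (auto simp: a_def b_def)
      qed (auto simp: a_def b_def)
      then show ?thesis using bij by (simp add: bij_betw_def)
    qed
  qed (use assms(2) simple in auto)
  finally show ?thesis
    by (simp add: k_def)
qed

end
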